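(* Let $m,n\ge 0$ be integers. The polynomial $F(m,m,n,n)$ is $(x+1)$-positive. More precisely, $$F(m,m,n,n)=\binom{m+n}{n}+2\sum_{i>0}(x+1)^i\sum_{0\le k<n}\binom{m+n}{k}\binom{m+n-k}{2n-2k}\binom{2n-2k-i-1}{n-k-1}.$$
   Context: A shuffle of words $V$ and $H$ is a word obtained by interleaving their letters, preserving the order within each (distinct interleavings counted separately). The signed peak-count of a shuffle is the number of occurrences of $\uparrow$ immediately followed by $\leftarrow$ minus the number of occurrences of $\rightarrow$ immediately followed by $\downarrow$. For nonnegative integers $r,l,u,d$, $F(r,l,u,d)\in\mathbb{Z}[x]$ is the polynomial $\sum_\sigma x^{|\text{signed peak-count of }\sigma|}$, summed over all shuffles $\sigma$ of a word $V$ with $u$ letters $\uparrow$ and $d$ letters $\downarrow$ with a word $H$ with $r$ letters $\rightarrow$ and $l$ letters $\leftarrow$ (this polynomial does not depend on the order of the letters in $V$ and $H$). A polynomial in $\mathbb{Z}[x]$ is $(x+1)$-positive if it lies in $\mathbb{N}_0[x+1]$, i.e. it is a polynomial in $x+1$ with nonnegative integer coefficients. Binomial coefficients $\binom{a}{b}$ are $0$ unless $0\le b\le a$. *)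

theory Defs
  imports
    "HOL-Computational_Algebra.Polynomial"
    "HOL-Library.Multiset"
    "HOL-Library.Groups_Big_Fun"
begin

datatype step = Up | Down | East | West

definition V_word :: "nat \<Rightarrow> nat \<Rightarrow> step list \<Rightarrow> bool" where
  "V_word u d V \<longleftrightarrow> mset V = replicate_mset u Up + replicate_mset d Down"

definition H_word :: "nat \<Rightarrow> nat \<Rightarrow> step list \<Rightarrow> bool" where
  "H_word r l H \<longleftrightarrow> mset H = replicate_mset r East + replicate_mset l West"

definition occurrences :: "step \<Rightarrow> step \<Rightarrow> step list \<Rightarrow> nat" where
  "occurrences a b w = card {i. Suc i < length w \<and> w ! i = a \<and> w ! Suc i = b}"

definition signed_peak_count :: "step list \<Rightarrow> int" where
  "signed_peak_count w = int (occurrences Up West w) - int (occurrences East Down w)"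

(* The polynomial F(r,l,u,d) is F_poly V H for any V_word u d V and H_word r l H; it does not
   depend on the order of the letters in V and H, so statements about F(r,l,u,d) are made for all
   such V and H. The set shuffles V H counts distinct interleavings separately, because V and H
   have no letter in common and an interleaving is therefore determined by the resulting word. *)
definition F_poly :: "step list \<Rightarrow> step list \<Rightarrow> int poly" where
  "F_poly V H = (\<Sum>w\<in>shuffles V H. monom 1 (nat \<bar>signed_peak_count w\<bar>))"

(* [:1, 1:] is the polynomial x + 1. *)
definition x_plus_1_positive :: "int poly \<Rightarrow> bool" where
  "x_plus_1_positive p \<longleftrightarrow> (\<exists>q. (\<forall>i. 0 \<le> coeff q i) \<and> p = pcompose q [:1, 1:])"

(* Arguments are integers because the upper one may become negative, where the value must be 0;
   truncated subtraction on nat would give (0 choose 0) = 1 instead. *)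
definition binom :: "int \<Rightarrow> int \<Rightarrow> nat" where
  "binom a b = (if 0 \<le> b \<and> b \<le> a then nat a choose nat b else 0)"

(* The inner sum, for exponent i > 0. It vanishes for i > n, so that the sum over all i > 0 has
   finite support and can be taken with Sum_any. *)
definition F_coeff :: "nat \<Rightarrow> nat \<Rightarrow> nat \<Rightarrow> nat" where
  "F_coeff m n i =
    (\<Sum>k<n. ((m + n) choose k) * ((m + n - k) choose (2 * n - 2 * k)) *
      binom (2 * int n - 2 * int k - int i - 1) (int n - int k - 1))"

lemma F_coeff_eq_0:
  assumes "n < i"
  shows "F_coeff m n i = 0"
  using assms by (auto simp: F_coeff_def binom_def)

end

theory Submission
  imports Defs
begin

text \<open>Comparing the first letters of \<open>V\<close> and \<open>H\<close> yields a linear recursion for the number of shuffles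
  with signed peak-count \<open>i\<close>, and \<open>binom (d + l) (d + i) * binom (u + r) (u - i)\<close> solves it. In
  the balanced case, with \<open>N = m + n\<close>, the coefficient of \<open>x ^ j\<close> for \<open>j > 0\<close> is therefore
  \<open>2 * (N choose (n + j)) * (N choose (n - j))\<close>. Sorting pairs of subsets of an \<open>N\<close>-element set by
  the size \<open>k\<close> of their intersection and expanding \<open>2 * (n - k) choose (n - k + j)\<close> by the
  hockey-stick identity gives the coefficients with respect to \<open>x + 1\<close>.\<close>

section \<open>Binomial coefficients with integer arguments\<close>

lemma binom_int: "binom (int a) b = (if 0 \<le> b then a choose nat b else 0)"
  by (auto simp: binom_def binomial_eq_0)

lemma binom_of_nat: "binom (int a) (int b) = a choose b"
  by (simp add: binom_int)

text \<open>For \<open>a = -1\<close> and \<open>b = 0\<close> the left side is 1 and the right side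
  0, hence the hypothesis.\<close>

lemma binom_pascal:
  assumes "0 \<le> a"
  shows "binom (a + 1) b = binom a b + binom a (b - 1)"
proof -
  obtain n where a: "a = int n"
    using assms nonneg_int_cases by blast
  have "binom (int (Suc n)) b = binom (int n) b + binom (int n) (b - 1)"
  proof (cases b)
    case (nonneg k)
    show ?thesis
    proof (cases k)
      case (Suc k')
      have "int (Suc k') - 1 = int k'" by simp
      then show ?thesis
        unfolding nonneg Suc by (simp only: binom_int nat_int) simp
    qed (simp only: nonneg binom_int, simp)
  qed (simp add: binom_def)
  then show ?thesis
    by (simp add: a add.commute)
qed

section \<open>Signed peak-counts of single words\<close>

lemma occurrences_Nil [simp]: "occurrences a b [] = 0"
  by (simp add: occurrences_def)

lemma occurrences_Cons:
  "occurrences a b (c # w) = occurrences a b w + of_bool (w \<noteq> [] \<and> c = a \<and> hd w = b)"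
proof -
  let ?A = "{i. Suc i < length w \<and> w ! i = a \<and> w ! Suc i = b}"
  have "{i. Suc i < length (c # w) \<and> (c # w) ! i = a \<and> (c # w) ! Suc i = b}
      = Suc ` ?A \<union> (if w \<noteq> [] \<and> c = a \<and> hd w = b then {0} else {})" (is "?L = ?R")
  proof (rule set_eqI)
    fix i show "i \<in> ?L \<longleftrightarrow> i \<in> ?R"
      by (cases i) (auto simp: hd_conv_nth)
  qed
  moreover have "finite ?A"
    by (rule finite_subset[of _ "{..<length w}"]) auto
  ultimately show ?thesis
    by (auto simp: occurrences_def card_insert_if card_image)
qed

lemma signed_peak_count_Cons:
  "signed_peak_count (c # w) = signed_peak_count w
     + of_bool (w \<noteq> [] \<and> c = Up \<and> hd w = West) - of_bool (w \<noteq> [] \<and> c = East \<and> hd w = Down)"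
  by (auto simp: signed_peak_count_def occurrences_Cons)

lemma signed_peak_count_one_axis:
  assumes "set w \<subseteq> {Up, Down} \<or> set w \<subseteq> {East, West}"
  shows "signed_peak_count w = 0"
  using assms
proof (induction w)
  case (Cons c w)
  then show ?case by (cases w) (auto simp: signed_peak_count_Cons)
qed (simp add: signed_peak_count_def)

section \<open>Recursion and product formula for shuffles\<close>

lemma sum_shuffles_Cons:
  fixes f :: "'a list \<Rightarrow> 'b::comm_monoid_add"
  assumes "v \<noteq> h"
  shows "sum f (shuffles (v # V) (h # H))
    = (\<Sum>w\<in>shuffles V (h # H). f (v # w)) + (\<Sum>w\<in>shuffles (v # V) H. f (h # w))"
proof -
  have "sum f (shuffles (v # V) (h # H))
      = sum f ((#) v ` shuffles V (h # H)) + sum f ((#) h ` shuffles (v # V) H)"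
    unfolding shuffles.simps using assms by (intro sum.union_disjoint) auto
  then show ?thesis
    by (simp add: sum.reindex inj_on_def)
qed

text \<open>Shuffles starting with a letter of \<open>V\<close> contribute equally to both sums; the
  others are \<open>h # w\<close> with \<open>w\<close> a shuffle of \<open>V\<close> and
  \<open>H\<close>.\<close>

lemma sum_shuffles_modify_hd:
  fixes f g :: "'a list \<Rightarrow> 'b::ab_group_add"
  assumes "h \<notin> set V"
    and "\<And>v w. v \<in> set V \<Longrightarrow> f (v # w) = g (v # w)"
  shows "sum f (shuffles V (h # H))
    = sum g (shuffles V (h # H)) + (\<Sum>w\<in>shuffles V H. f (h # w) - g (h # w))"
proof (cases V)
  case (Cons v V')
  then have "v \<noteq> h" and "\<And>w. f (v # w) = g (v # w)"
    using assms by auto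
  then show ?thesis
    by (simp add: Cons sum_shuffles_Cons sum_subtractf del: shuffles.simps)
qed simp

text \<open>Integer-valued because the recursion subtracts, and indexed by the signed value because
  it shifts \<open>i\<close> by one either way.\<close>

definition peak_number :: "step list \<Rightarrow> step list \<Rightarrow> int \<Rightarrow> int" where
  "peak_number V H i = (\<Sum>w\<in>shuffles V H. of_bool (signed_peak_count w = i))"

text \<open>Only a word that starts with \<open>Up, West\<close> or \<open>East, Down\<close> changes its signed peak-count when
  the first letter is removed; the words starting with both first letters are the shuffles of the
  two tails, which gives the correction terms.\<close>
lemma peak_number_Cons:
  assumes V: "set (v # V) \<subseteq> {Up, Down}" and H: "set (h # H) \<subseteq> {East, West}"
  shows "peak_number (v # V) (h # H) i
    = peak_number V (h # H) i + peak_number (v # V) H i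
      + (if v = Up \<and> h = West then peak_number V H (i - 1) - peak_number V H i
         else if v = Down \<and> h = East then peak_number V H (i + 1) - peak_number V H i
         else 0)"
proof -
  define g :: "step list \<Rightarrow> int" where "g w = of_bool (signed_peak_count w = i)" for w
  have "(\<Sum>w\<in>shuffles V (h # H). g (v # w))
      = sum g (shuffles V (h # H)) + (\<Sum>w\<in>shuffles V H. g (v # h # w) - g (h # w))"
    by (rule sum_shuffles_modify_hd) (use V H in \<open>auto simp: g_def signed_peak_count_Cons\<close>)
  also have "(\<Sum>w\<in>shuffles V H. g (v # h # w) - g (h # w))
      = (if v = Up \<and> h = West then peak_number V H (i - 1) - peak_number V H i else 0)"
    using V H by (auto simp: g_def signed_peak_count_Cons peak_number_def sum_subtractf eq_diff_eq)
  finally have 1: "(\<Sum>w\<in>shuffles V (h # H). g (v # w)) = sum g (shuffles V (h # H)) + \<dots>" .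
  have "(\<Sum>w\<in>shuffles H (v # V). g (h # w))
      = sum g (shuffles H (v # V)) + (\<Sum>w\<in>shuffles H V. g (h # v # w) - g (v # w))"
    by (rule sum_shuffles_modify_hd) (use V H in \<open>auto simp: g_def signed_peak_count_Cons\<close>)
  also have "(\<Sum>w\<in>shuffles H V. g (h # v # w) - g (v # w))
      = (if v = Down \<and> h = East then peak_number V H (i + 1) - peak_number V H i else 0)"
    using V H by (auto simp: g_def signed_peak_count_Cons peak_number_def sum_subtractf
        shuffles_commutes[of H V] diff_eq_eq)
  finally have 2: "(\<Sum>w\<in>shuffles (v # V) H. g (h # w)) = sum g (shuffles (v # V) H) + \<dots>"
    by (simp only: shuffles_commutes[of H "v # V"])
  have "v \<noteq> h" using V H by auto
  then have "sum g (shuffles (v # V) (h # H))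
      = (\<Sum>w\<in>shuffles V (h # H). g (v # w)) + (\<Sum>w\<in>shuffles (v # V) H. g (h # w))"
    by (rule sum_shuffles_Cons)
  then show ?thesis
    using 1 2 by (auto simp: peak_number_def g_def)
qed

text \<open>For first letters \<open>Up\<close>, \<open>East\<close> or \<open>Down\<close>,
  \<open>West\<close>, Pascal's rule for one factor suffices. In the other two cases both factors
  are expanded, and the correction terms of the recursion supply the difference.\<close>

lemma peak_number_eq:
  assumes "set V \<subseteq> {Up, Down}" and "set H \<subseteq> {East, West}"
  shows "peak_number V H i =
    int (binom (int (count_list V Down + count_list H West)) (int (count_list V Down) + i)
       * binom (int (count_list V Up + count_list H East)) (int (count_list V Up) - i))"
  using assms
proof (induction "length V + length H" arbitrary: V H i rule: less_induct)
  case less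
  show ?case
  proof (cases "V = [] \<or> H = []")
    case True
    \<comment> \<open>There is a single shuffle, with count 0, and the product is 0 unless
      \<open>i = 0\<close>.\<close>
    then show ?thesis
      using less.prems by (auto simp: peak_number_def signed_peak_count_one_axis binom_def)
  next
    case False
    then obtain v V' h H' where VH: "V = v # V'" "H = h # H'"
      by (meson neq_Nil_conv)
    define D U where "D = int (count_list V' Down)" and "U = int (count_list V' Up)"
    define X where "X = D + int (count_list H' West)"
    define Y where "Y = U + int (count_list H' East)"
    have IH1: "peak_number V' H j = int (binom (X + of_bool (h = West)) (D + j)
        * binom (Y + of_bool (h = East)) (U - j))" for j
      using less.hyps[of V' H j] less.prems by (auto simp: VH D_def U_def X_def Y_def ac_simps)
    have IH2: "peak_number V H' j = int (binom (X + of_bool (v = Down)) (D + of_bool (v = Down) + j)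
        * binom (Y + of_bool (v = Up)) (U + of_bool (v = Up) - j))" for j
      using less.hyps[of V H' j] less.prems by (auto simp: VH D_def U_def X_def Y_def ac_simps)
    have IH3: "peak_number V' H' j = int (binom X (D + j) * binom Y (U - j))" for j
      using less.hyps[of V' H' j] less.prems by (simp add: VH D_def U_def X_def Y_def)
    have rec: "peak_number V H i = peak_number V' H i + peak_number V H' i
      + (if v = Up \<and> h = West then peak_number V' H' (i - 1) - peak_number V' H' i
         else if v = Down \<and> h = East then peak_number V' H' (i + 1) - peak_number V' H' i
         else 0)"
      unfolding VH by (rule peak_number_Cons) (use less.prems VH in auto)
    have pascal: "binom (X + 1) b = binom X b + binom X (b - 1)"
      "binom (X + 2) b = binom (X + 1) b + binom (X + 1) (b - 1)"
      "binom (Y + 1) b = binom Y b + binom Y (b - 1)"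
      "binom (Y + 2) b = binom (Y + 1) b + binom (Y + 1) (b - 1)" for b
      using binom_pascal[of X b] binom_pascal[of "X + 1" b] binom_pascal[of Y b] binom_pascal[of "Y + 1" b]
      by (simp_all add: X_def Y_def D_def U_def add.assoc)
    have pascal': "binom (1 + X) b = binom X b + binom X (b - 1)"
      "binom (1 + Y) b = binom Y b + binom Y (b - 1)" for b
      using pascal(1,3)[of b] by (simp_all add: add.commute)
    have counts:
      "int (count_list V Down + count_list H West) = X + (of_bool (v = Down) + of_bool (h = West))"
      "int (count_list V Up + count_list H East) = Y + (of_bool (v = Up) + of_bool (h = East))"
      "int (count_list V Down) = D + of_bool (v = Down)"
      "int (count_list V Up) = U + of_bool (v = Up)"
      by (simp_all add: VH D_def U_def X_def Y_def)
    from less.prems VH consider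
      "v = Up" "h = East" | "v = Up" "h = West" | "v = Down" "h = East" | "v = Down" "h = West"
      by auto
    then show ?thesis
      unfolding rec IH1 IH2 IH3 counts by cases (simp_all add: pascal, simp_all add: pascal' algebra_simps)
  qed
qed

section \<open>Coefficients of \<open>F_poly\<close> in powers of \<open>x\<close>\<close>

lemma count_list_V_word:
  assumes "V_word u d V"
  shows "count_list V Up = u" "count_list V Down = d" "set V \<subseteq> {Up, Down}"
proof -
  have V: "mset V = replicate_mset u Up + replicate_mset d Down"
    using assms by (simp add: V_word_def)
  show "count_list V Up = u" "count_list V Down = d"
    by (simp_all add: V flip: count_mset)
  show "set V \<subseteq> {Up, Down}"
    using V by (auto simp flip: set_mset_mset split: if_splits)
qed

lemma count_list_H_word:
  assumes "H_word r l H"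
  shows "count_list H East = r" "count_list H West = l" "set H \<subseteq> {East, West}"
proof -
  have H: "mset H = replicate_mset r East + replicate_mset l West"
    using assms by (simp add: H_word_def)
  show "count_list H East = r" "count_list H West = l"
    by (simp_all add: H flip: count_mset)
  show "set H \<subseteq> {East, West}"
    using H by (auto simp flip: set_mset_mset split: if_splits)
qed

text \<open>Only the letter counts enter, so the order of the letters in \<open>V\<close> and
  \<open>H\<close> is irrelevant.\<close>

lemma card_signed_peak_count:
  assumes V: "V_word u d V" and H: "H_word r l H"
  shows "card {w \<in> shuffles V H. signed_peak_count w = i}
    = binom (int (d + l)) (int d + i) * binom (int (u + r)) (int u - i)"
proof -
  have "int (card {w \<in> shuffles V H. signed_peak_count w = i}) = peak_number V H i"
    by (simp add: peak_number_def Int_def)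
  then show ?thesis
    using peak_number_eq[of V H i] count_list_V_word[OF V] count_list_H_word[OF H]
    by (metis of_nat_eq_iff)
qed

lemma coeff_F_poly:
  "coeff (F_poly V H) j = int (card {w \<in> shuffles V H. nat \<bar>signed_peak_count w\<bar> = j})"
  by (simp add: F_poly_def coeff_sum Int_def flip: of_bool_def)

text \<open>Both upper indices are \<open>m + n\<close>, so negating the signed peak-count swaps the
  two factors. The values \<open>j\<close> and \<open>- j\<close> thus contribute equally, and they
  coincide for \<open>j = 0\<close>.\<close>

lemma coeff_F_poly_balanced:
  assumes V: "V_word n n V" and H: "H_word m m H"
  shows "coeff (F_poly V H) j
    = (if j = 0 then 1 else 2) * int (((m + n) choose (n + j)) * binom (int (m + n)) (int n - int j))"
proof -
  have card: "card {w \<in> shuffles V H. signed_peak_count w = i}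
    = binom (int (m + n)) (int n + i) * binom (int (m + n)) (int n - i)" for i
    using card_signed_peak_count[OF assms, of i] by (simp add: add.commute)
  have "card {w \<in> shuffles V H. signed_peak_count w = int j}
      = ((m + n) choose (n + j)) * binom (int (m + n)) (int n - int j)"
    by (simp only: card binom_of_nat flip: of_nat_add)
  moreover have "card {w \<in> shuffles V H. signed_peak_count w = - int j}
      = ((m + n) choose (n + j)) * binom (int (m + n)) (int n - int j)"
    by (simp only: card binom_of_nat diff_minus_eq_add add_uminus_conv_diff mult.commute flip: of_nat_add)
  moreover have "{w \<in> shuffles V H. nat \<bar>signed_peak_count w\<bar> = j}
     = {w \<in> shuffles V H. signed_peak_count w = int j} \<union> {w \<in> shuffles V H. signed_peak_count w = - int j}"
    by auto
  moreover have "{w \<in> shuffles V H. signed_peak_count w = int j} \<inter> {w \<in> shuffles V H. signed_peak_count w = - int j} = {}" if "j > 0"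
    using that by auto
  ultimately show ?thesis
    unfolding coeff_F_poly
    by (cases "j = 0") (simp_all add: card_Un_disjoint)
qed

section \<open>Binomial sums\<close>

text \<open>Counts the subsets of \<open>{0..M}\<close> with \<open>j + q + 1\<close> elements by
  the element \<open>i\<close> that has \<open>j\<close> elements below it and \<open>q\<close>
  above.\<close>

lemma sum_choose_mult_choose:
  "(\<Sum>i\<le>M. (i choose j) * ((M - i) choose q)) = Suc M choose Suc (j + q)"
proof (induction M arbitrary: q)
  case 0
  then show ?case by (cases j; cases q) auto
next
  case (Suc M)
  show ?case
  proof (cases q)
    case 0
    then show ?thesis
      using sum_choose_upper[of j "Suc M"] by simp
  next
    case (Suc q')
    \<comment> \<open>Pascal's rule in \<open>q\<close> splits each term except
      \<open>i = Suc M\<close>, which is 0 because \<open>q > 0\<close>.\<close>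
    have "(\<Sum>i\<le>Suc M. (i choose j) * ((Suc M - i) choose q))
        = (\<Sum>i\<le>M. (i choose j) * ((M - i) choose q')) + (\<Sum>i\<le>M. (i choose j) * ((M - i) choose q))"
      unfolding sum.distrib[symmetric] by (simp add: Suc Suc_diff_le algebra_simps)
    then show ?thesis
      by (simp only: Suc.IH) (simp add: Suc)
  qed
qed

text \<open>The case \<open>M = 2 * p - 1\<close>, \<open>q = p - 1\<close>. Terms with
  \<open>i > p\<close> vanish, so one upper limit \<open>n\<close> serves all
  \<open>p \<le> n\<close>.\<close>

lemma sum_choose_mult_binom:
  assumes "0 < p" and "p \<le> n"
  shows "(\<Sum>i\<le>n. (i choose j) * binom (2 * int p - int i - 1) (int p - 1)) = 2 * p choose (p + j)"
proof -
  have "(\<Sum>i\<le>n. (i choose j) * binom (2 * int p - int i - 1) (int p - 1))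
      = (\<Sum>i\<le>2 * p - 1. (i choose j) * ((2 * p - 1 - i) choose (p - 1)))"
  proof (rule sum.mono_neutral_cong)
    fix i assume "i \<in> {..n} \<inter> {..2 * p - 1}"
    then have eq: "2 * int p - int i - 1 = int (2 * p - 1 - i)" "int p - 1 = int (p - 1)"
      using assms by auto
    then show "(i choose j) * binom (2 * int p - int i - 1) (int p - 1)
        = (i choose j) * ((2 * p - 1 - i) choose (p - 1))"
      by (simp only: eq binom_of_nat)
  qed (use assms in \<open>auto simp: binom_def\<close>)
  also have "\<dots> = 2 * p choose (p + j)"
    using assms by (subst sum_choose_mult_choose) (simp add: add.commute)
  finally show ?thesis .
qed

text \<open>The left side is the coefficient of \<open>x ^ j\<close> in the sum of
  \<open>F_coeff m n i * (x + 1) ^ i\<close>. After exchanging sums, the inner one is evaluated with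
  \<open>p = n - k\<close>.\<close>

lemma sum_choose_F_coeff:
  "(\<Sum>i\<le>n. (i choose j) * F_coeff m n i)
    = (\<Sum>k<n. ((m + n) choose k) * ((m + n - k) choose (2 * (n - k))) * (2 * (n - k) choose (n - k + j)))"
proof -
  have "(\<Sum>i\<le>n. (i choose j) * F_coeff m n i)
      = (\<Sum>k<n. \<Sum>i\<le>n. ((m + n) choose k) * ((m + n - k) choose (2 * n - 2 * k))
          * ((i choose j) * binom (2 * int n - 2 * int k - int i - 1) (int n - int k - 1)))"
    unfolding F_coeff_def sum_distrib_left by (subst sum.swap) (simp add: ac_simps)
  also have "\<dots> = (\<Sum>k<n. ((m + n) choose k) * ((m + n - k) choose (2 * (n - k))) * (2 * (n - k) choose (n - k + j)))"
  proof (rule sum.cong)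
    fix k assume "k \<in> {..<n}"
    then have "0 < n - k" "n - k \<le> n" and k: "int (n - k) = int n - int k"
      by auto
    then show "(\<Sum>i\<le>n. ((m + n) choose k) * ((m + n - k) choose (2 * n - 2 * k))
          * ((i choose j) * binom (2 * int n - 2 * int k - int i - 1) (int n - int k - 1)))
       = ((m + n) choose k) * ((m + n - k) choose (2 * (n - k))) * (2 * (n - k) choose (n - k + j))"
      using sum_choose_mult_binom[of "n - k" n j]
      by (simp add: k right_diff_distrib diff_mult_distrib2 flip: sum_distrib_left)
  qed simp
  finally show ?thesis .
qed

text \<open>Evaluates the term \<open>i = 0\<close>, which the hockey-stick sum contains but the
  theorem omits, by halving central binomial coefficients.\<close>

lemma F_coeff_0:
  "2 * F_coeff m n 0
    = (\<Sum>k<n. ((m + n) choose k) * ((m + n - k) choose (2 * (n - k))) * (2 * (n - k) choose (n - k)))"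
  unfolding F_coeff_def sum_distrib_left
proof (rule sum.cong)
  fix k assume "k \<in> {..<n}"
  then obtain p where p: "n = k + Suc p"
    using less_iff_Suc_add by auto
  have central: "2 * Suc p choose Suc p = 2 * ((2 * p + 1) choose p)"
    using binomial_symmetric[of p "2 * p + 1"] by simp
  have eq: "2 * int n - 2 * int k - int 0 - 1 = int (2 * p + 1)" "int n - int k - 1 = int p"
    by (simp_all add: p)
  show "2 * (((m + n) choose k) * ((m + n - k) choose (2 * n - 2 * k))
        * binom (2 * int n - 2 * int k - int 0 - 1) (int n - int k - 1))
     = ((m + n) choose k) * ((m + n - k) choose (2 * (n - k))) * (2 * (n - k) choose (n - k))"
    unfolding eq binom_of_nat using central by (simp add: p del: binomial_Suc_Suc)
qed simp

text \<open>Both sides count pairs of subsets of an \<open>N\<close>-element set of sizes \<open>n + j\<close> and \<open>n - j\<close>;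
  the index \<open>k\<close> is the size of their intersection.\<close>
lemma sum_choose_pairs:
  "(\<Sum>k\<le>n. (N choose k) * ((N - k) choose (2 * (n - k))) * (2 * (n - k) choose (n - k + j)))
    = (N choose (n + j)) * binom (int N) (int n - int j)"
proof (cases "j \<le> n \<and> n + j \<le> N")
  case False
  \<comment> \<open>A nonzero term would force \<open>j \<le> n - k\<close> and
    \<open>2 * n - k \<le> N\<close>, hence \<open>j \<le> n\<close> and
    \<open>n + j \<le> N\<close>.\<close>
  have "(N choose k) * ((N - k) choose (2 * (n - k))) * (2 * (n - k) choose (n - k + j)) = 0" if "k \<le> n" for k
  proof -
    consider "N < k" | "2 * (n - k) < n - k + j" | "N - k < 2 * (n - k)"
      using False that by linarith
    then show ?thesis
      by cases (simp_all add: binomial_eq_0)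
  qed
  then show ?thesis
    using False by (auto simp: binom_int binomial_eq_0)
next
  case True
  have "(\<Sum>k\<le>n. (N choose k) * ((N - k) choose (2 * (n - k))) * (2 * (n - k) choose (n - k + j)))
     = (\<Sum>k\<le>n - j. (N choose (n + j)) * (((n + j) choose k) * ((N - (n + j)) choose (n - j - k))))"
  proof (rule sum.mono_neutral_cong_right)
    fix k assume "k \<in> {..n - j}"
    then have k: "k + j \<le> n"
      using True by auto
    \<comment> \<open>Choose the larger set and then the intersection, or the intersection and then
      the rest of the larger set.\<close>
    have eq: "(N choose (n + j)) * ((n + j) choose k) = (N choose k) * ((N - k) choose (n - k + j))"
      using True k choose_mult[of k "n + j" N] by simp
    \<comment> \<open>The symmetric difference has \<open>2 * (n - k)\<close> elements; it is chosen
      as a whole and then split, or one part after the other.\<close>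
    have "((N - k) choose (2 * (n - k))) * (2 * (n - k) choose (n - k + j))
        = ((N - k) choose (n - k + j)) * ((N - (n + j)) choose (n - j - k))"
    proof (cases "2 * (n - k) \<le> N - k")
      case True
      have "N - k - (n - k + j) = N - (n + j)" "2 * (n - k) - (n - k + j) = n - j - k"
        using k by auto
      then show ?thesis
        using True k choose_mult[of "n - k + j" "2 * (n - k)" "N - k"] by simp
    next
      case False
      then have "N - (n + j) < n - j - k"
        using True k by linarith
      then show ?thesis
        using False by (simp add: binomial_eq_0)
    qed
    then show "(N choose k) * ((N - k) choose (2 * (n - k))) * (2 * (n - k) choose (n - k + j))
        = (N choose (n + j)) * (((n + j) choose k) * ((N - (n + j)) choose (n - j - k)))"
      using eq by (metis mult.assoc)
  qed (auto simp: binomial_eq_0)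
  also have "\<dots> = (N choose (n + j)) * (N choose (n - j))"
    using True vandermonde[of "n + j" "N - (n + j)" "n - j"] by (simp flip: sum_distrib_left)
  finally show ?thesis
    using True by (simp add: binom_int nat_diff_distrib)
qed

section \<open>Comparison of coefficients and positivity\<close>

lemma sum_F_coeff:
  "of_bool (j = 0) * ((m + n) choose n) + 2 * (\<Sum>i=1..n. (i choose j) * F_coeff m n i)
    = (if j = 0 then 1 else 2) * (((m + n) choose (n + j)) * binom (int (m + n)) (int n - int j))"
proof -
  define S where "S = (\<Sum>k<n. ((m + n) choose k) * ((m + n - k) choose (2 * (n - k)))
    * (2 * (n - k) choose (n - k + j)))"
  \<comment> \<open>The term \<open>k = n\<close>, left out of \<open>S\<close>, is nonzero only for
    \<open>j = 0\<close> and yields the constant of the theorem.\<close>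
  have S: "((m + n) choose (n + j)) * binom (int (m + n)) (int n - int j)
      = S + ((m + n) choose n) * of_bool (j = 0)"
    unfolding sum_choose_pairs[symmetric] S_def lessThan_Suc_atMost[symmetric] by simp
  have "S = (0 choose j) * F_coeff m n 0 + (\<Sum>i=1..n. (i choose j) * F_coeff m n i)"
    unfolding S_def sum_choose_F_coeff[symmetric]
    by (simp add: atMost_atLeast0 sum.atLeast_Suc_atMost)
  \<comment> \<open>For \<open>j = 0\<close> the term \<open>i = 0\<close> is half of
    \<open>S\<close>, so twice the remaining sum is \<open>S\<close>; for \<open>j > 0\<close> that
    term vanishes and \<open>2 * S\<close> results.\<close>
  moreover have "2 * F_coeff m n 0 = S" if "j = 0"
    by (simp add: that S_def F_coeff_0)
  ultimately show ?thesis
    unfolding S by (cases "j = 0") auto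
qed

theorem theorem3p13:
  fixes m n :: nat and V H :: "step list"
  assumes "V_word n n V" and "H_word m m H"
  shows "x_plus_1_positive (F_poly V H) \<and>
    F_poly V H = of_nat ((m + n) choose n)
      + 2 * Sum_any (\<lambda>i. if i > 0 then of_nat (F_coeff m n i) * [:1, 1:] ^ i else 0)"
proof -
  have Sum: "Sum_any (\<lambda>i. if i > 0 then of_nat (F_coeff m n i) * [:1, 1:] ^ i else 0)
      = (\<Sum>i=1..n. of_nat (F_coeff m n i) * [:1, 1 :: int:] ^ i)"
  proof -
    have "{i. (if i > 0 then of_nat (F_coeff m n i) * [:1, 1 :: int:] ^ i else 0) \<noteq> 0} \<subseteq> {1..n}"
    proof (intro subsetI)
      fix i assume "i \<in> {i. (if i > 0 then of_nat (F_coeff m n i) * [:1, 1 :: int:] ^ i else 0) \<noteq> 0}"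
      then have "0 < i" "F_coeff m n i \<noteq> 0"
        by (auto split: if_splits)
      then show "i \<in> {1..n}"
        using F_coeff_eq_0[of n i m] by force
    qed
    then show ?thesis
      by (subst Sum_any.expand_superset) auto
  qed
  have F: "F_poly V H = of_nat ((m + n) choose n) + 2 * (\<Sum>i=1..n. of_nat (F_coeff m n i) * [:1, 1:] ^ i)"
  proof (rule poly_eqI)
    fix j
    have coeff_power: "coeff ([:1, 1 :: int:] ^ i) j = int (i choose j)" for i
      by (cases "j \<le> i")
        (simp_all add: coeff_linear_poly_power binomial_eq_0 coeff_eq_0 degree_linear_power)
    have coeff_const: "coeff (of_nat a :: int poly) j = of_bool (j = 0) * int a" for a
      by (cases j) (simp_all add: of_nat_poly)
    have "coeff (of_nat ((m + n) choose n) + 2 * (\<Sum>i=1..n. of_nat (F_coeff m n i) * [:1, 1 :: int:] ^ i)) j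
      = int (of_bool (j = 0) * ((m + n) choose n) + 2 * (\<Sum>i=1..n. (i choose j) * F_coeff m n i))"
      by (simp add: coeff_sum coeff_power of_nat_mult_conv_smult numeral_mult_conv_smult
          coeff_const mult.commute)
    then show "coeff (F_poly V H) j
      = coeff (of_nat ((m + n) choose n) + 2 * (\<Sum>i=1..n. of_nat (F_coeff m n i) * [:1, 1:] ^ i)) j"
      unfolding sum_F_coeff using coeff_F_poly_balanced[OF assms, of j] by simp
  qed
  have "x_plus_1_positive (F_poly V H)"
    unfolding x_plus_1_positive_def
  proof (intro exI conjI allI)
    \<comment> \<open>The coefficients are read off from the expansion \<open>F\<close>.\<close>
    let ?q = "[:int ((m + n) choose n):] + (\<Sum>i=1..n. monom (2 * int (F_coeff m n i)) i)"
    show "0 \<le> coeff ?q j" for j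
      by (auto simp: coeff_sum coeff_pCons split: nat.split intro!: add_nonneg_nonneg sum_nonneg)
    have "pcompose ([:0, 1:] ^ i) [:1, 1 :: int:] = [:1, 1:] ^ i" for i
      by (induction i) (simp_all add: pcompose_1 pcompose_mult pcompose_pCons)
    then show "F_poly V H = pcompose ?q [:1, 1:]"
      by (simp add: F monom_altdef pcompose_add pcompose_sum pcompose_smult sum_distrib_left of_nat_poly numeral_poly
          mult.commute)
  qed
  then show ?thesis
    using F Sum by simp
qed

end
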